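(* There exist distribution functions $F$, $F_1$, and $F_2$ on $\mathbb{R}$ such that $F=F_1*F_2$ and $F\in\boldsymbol{I}$, but $F_1\notin\boldsymbol{Q}$ and $F_2\notin\boldsymbol{Q}$.
   Context: Distribution functions are distribution functions of probability laws on the real line $\mathbb{R}$, and $*$ denotes convolution of distribution functions (i.e. $F=F_1*F_2$ is the distribution function of the sum of two independent random variables with distribution functions $F_1$ and $F_2$; equivalently, the characteristic functions multiply). A distribution function $F$ is infinitely divisible if for every positive integer $n$ there exists a distribution function $F_{1/n}$ such that $F=(F_{1/n})^{*n}$ ($n$-fold convolution power). The class of all infinitely divisible distribution functions is denoted by $\boldsymbol{I}$. A distribution function $F$ is rational-infinitely divisible if there exist infinitely divisible distribution functions $H_1,H_2\in\boldsymbol{I}$ such that $H_1=F*H_2$. The class of all rational-infinitely divisible distribution functions is denoted by $\boldsymbol{Q}$; thus $\boldsymbol{I}\subset\boldsymbol{Q}$. *)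

theory Defs
  imports "HOL-Probability.Probability"
begin

definition distribution_function :: "(real \<Rightarrow> real) \<Rightarrow> bool" where
  "distribution_function F \<longleftrightarrow> (\<exists>M. real_distribution M \<and> F = cdf M)"

text \<open>
  The law with distribution function \<open>F\<close> is \<open>interval_measure F\<close>
  (see \<open>interval_measure_cdf\<close>); the library's \<open>convolution\<close> of two laws is the image of the
  product measure under addition, that is, the law of the sum of two independent variables.
\<close>

definition df_conv :: "(real \<Rightarrow> real) \<Rightarrow> (real \<Rightarrow> real) \<Rightarrow> (real \<Rightarrow> real)" where
  "df_conv F G = cdf (convolution (interval_measure F) (interval_measure G))"

text \<open>The zeroth power is the unit of convolution, the law concentrated at \<open>0\<close>.\<close>

primrec df_conv_power :: "(real \<Rightarrow> real) \<Rightarrow> nat \<Rightarrow> (real \<Rightarrow> real)" where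
  "df_conv_power F 0 = cdf (return borel 0)"
| "df_conv_power F (Suc n) = df_conv F (df_conv_power F n)"

definition infinitely_divisible :: "(real \<Rightarrow> real) set" where
  "infinitely_divisible = {F. distribution_function F \<and>
     (\<forall>n::nat. n > 0 \<longrightarrow> (\<exists>G. distribution_function G \<and> F = df_conv_power G n))}"

definition rational_infinitely_divisible :: "(real \<Rightarrow> real) set" where
  "rational_infinitely_divisible = {F. distribution_function F \<and>
     (\<exists>H1 \<in> infinitely_divisible. \<exists>H2 \<in> infinitely_divisible. H1 = df_conv F H2)}"

lemma interval_measure_cdf:
  assumes "real_distribution M"
  shows "interval_measure (cdf M) = M"
proof -
  interpret real_distribution M by fact
  show ?thesis
  proof (rule cdf_unique)
    show "real_distribution (interval_measure (cdf M))"
      by (rule real_distribution_interval_measure)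
        (auto intro: cdf_nondecreasing cdf_is_right_cont cdf_lim_at_bot cdf_lim_at_top_prob)
    show "cdf (interval_measure (cdf M)) = cdf M"
      by (rule cdf_interval_measure)
        (auto intro: cdf_nondecreasing cdf_is_right_cont cdf_lim_at_bot)
  qed fact
qed

lemma df_conv_cdf:
  assumes "real_distribution M" and "real_distribution N"
  shows "df_conv (cdf M) (cdf N) = cdf (convolution M N)"
  using assms by (simp add: df_conv_def interval_measure_cdf)

lemma (in prob_space) df_conv_indep_sum:
  fixes X Y :: "'a \<Rightarrow> real"
  assumes "indep_var borel X borel Y"
  shows "df_conv (cdf (distr M borel X)) (cdf (distr M borel Y))
    = cdf (distr M borel (\<lambda>\<omega>. X \<omega> + Y \<omega>))"
proof -
  have [measurable]: "random_variable borel X" "random_variable borel Y"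
    using assms by (auto dest: indep_var_rv1 indep_var_rv2)
  show ?thesis
    using assms by (simp add: df_conv_cdf sum_indep_random_variable)
qed

lemma df_conv_power_1:
  assumes "distribution_function F"
  shows "df_conv_power F 1 = F"
proof -
  obtain M where M: "real_distribution M" and F: "F = cdf M"
    using assms by (auto simp: distribution_function_def)
  interpret real_distribution M by fact
  interpret R: prob_space "return borel (0::real)"
    by (rule prob_space_return) simp
  have R: "real_distribution (return borel (0::real))"
    by unfold_locales simp
  have "convolution M (return borel 0) = M"
  proof (rule measure_eqI)
    fix A assume "A \<in> sets (convolution M (return borel (0::real)))"
    then have A [measurable]: "A \<in> sets borel"
      by simp
    have "emeasure (convolution M (return borel 0)) A
        = (\<integral>\<^sup>+x. \<integral>\<^sup>+y. indicator A (x + y) \<partial>return borel 0 \<partial>M)"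
      by (rule convolution_emeasure')
        (auto intro: finite_measure_axioms R.finite_measure_axioms)
    also have "\<dots> = (\<integral>\<^sup>+x. indicator A x \<partial>M)"
      by (intro nn_integral_cong) (simp add: nn_integral_return)
    finally show "emeasure (convolution M (return borel 0)) A = emeasure M A"
      by simp
  qed simp
  then show ?thesis
    by (simp add: F df_conv_cdf[OF M R])
qed

end

theory Submission
  imports Defs "HOL-Real_Asymp.Real_Asymp"
begin

text \<open>
  If \<open>h\<close> is an infinitely divisible characteristic function, then \<open>- ln |h|\<^sup>2\<close> is the limit of
  \<open>n (1 - |h\<^sub>n|\<^sup>2)\<close> with \<open>h\<^sub>n\<close> the \<open>n\<close>-th convolution root, and \<open>|sin (a + b)| \<le> |sin a| + |sin b|\<close> makes its
  square root subadditive. By Fekete's lemma \<open>ln |h n| / n\<^sup>2\<close> converges, and hence so does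
  \<open>ln |f n| / n\<^sup>2\<close> for every rational-infinitely divisible \<open>f\<close>. The functions
  \<open>exp (- 3|t| - t\<^sup>2 (1 \<plusminus> (1/2) cos (ln (1 + |t|))))\<close> violate this. The oscillation is so slow that both
  are convex on the positive half-line, hence characteristic functions by Polya's criterion; their
  product \<open>exp (- 6|t| - 2t\<^sup>2)\<close> belongs to the convolution of a Cauchy and a normal law.
\<close>

section \<open>Polya's criterion\<close>

lemma norm_iexp [simp]: "cmod (iexp x) = 1"
  by (simp add: norm_exp_i_times)

lemma integral_std_normal_density_iexp:
  "(CLBINT x. std_normal_density x * iexp (t * x)) = complex_of_real (exp (- (t^2) / 2))"
proof -
  have "(CLBINT x. std_normal_density x * iexp (t * x)) = char std_normal_distribution t"
    unfolding char_def
    by (subst integral_density) (auto simp: scaleR_conv_of_real)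
  then show ?thesis by (simp add: char_std_normal_distribution)
qed

lemma integrable_std_normal_density: "integrable lborel std_normal_density"
  by simp

text \<open>The Gaussian factor makes the double integral absolutely convergent, so Fubini applies.
  The inner integral over \<open>x\<close> is then the characteristic function of a normal law,
  hence a Gaussian of width \<open>\<epsilon>\<close> around \<open>s\<close>, and
  \<open>t = s + \<epsilon> * z\<close> rescales it.\<close>

lemma fourier_gaussian_mean:
  fixes \<phi> :: "real \<Rightarrow> complex" and \<epsilon> s :: real
  assumes int: "integrable lborel \<phi>" and \<epsilon>: "\<epsilon> > 0"
  shows "(CLBINT x. iexp (s * x) * (CLBINT t. iexp (- (t * x)) * \<phi> t) * std_normal_density (\<epsilon> * x))
    = sqrt (2 * pi) * (CLBINT z. \<phi> (s + \<epsilon> * z) * std_normal_density z)"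
proof -
  interpret pair_sigma_finite "lborel :: real measure" "lborel :: real measure" ..
  have [measurable]: "\<phi> \<in> borel_measurable borel"
    using borel_measurable_integrable[OF int] by simp
  have gauss: "integrable lborel (\<lambda>x. std_normal_density (\<epsilon> * x))"
    using lborel_integrable_real_affine[OF integrable_std_normal_density, of \<epsilon> 0] \<epsilon> by simp
  define K where "K x t = iexp (s * x) * (iexp (- (t * x)) * \<phi> t) * std_normal_density (\<epsilon> * x)" for x t
  have Kint: "integrable (lborel \<Otimes>\<^sub>M lborel) (case_prod K)"
  proof (rule lborel_pair.Fubini_integrable)
    show "case_prod K \<in> borel_measurable (lborel \<Otimes>\<^sub>M lborel)"
      unfolding K_def by measurable
    have "(\<lambda>x. LBINT y. cmod (case (x, y) of (x, xa) \<Rightarrow> K x xa))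
       = (\<lambda>x. std_normal_density (\<epsilon> * x) * (LBINT y. cmod (\<phi> y)))"
      by (auto simp: K_def norm_mult fun_eq_iff)
    then show "integrable lborel (\<lambda>x. LBINT y. cmod (case (x, y) of (x, xa) \<Rightarrow> K x xa))"
      using gauss by simp
    have "integrable lborel (\<lambda>t. K x t)" for x
    proof -
      have "integrable lborel (\<lambda>t. iexp (- (t * x)) * \<phi> t)"
        by (rule Bochner_Integration.integrable_bound[OF int]) (auto simp: norm_mult simp del: of_real_mult of_real_minus)
      then show ?thesis unfolding K_def by simp
    qed
    then show "AE x in lborel. integrable lborel (\<lambda>y. case (x, y) of (x, xa) \<Rightarrow> K x xa)"
      by simp
  qed
  have "(CLBINT x. iexp (s * x) * (CLBINT t. iexp (- (t * x)) * \<phi> t) * std_normal_density (\<epsilon> * x))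
    = (CLBINT x. CLBINT t. K x t)"
    unfolding K_def by simp
  also have "\<dots> = (CLBINT t. CLBINT x. K x t)"
    using lborel_pair.Fubini_integral[OF Kint] by simp
  also have "\<dots> = (CLBINT t. \<phi> t * (sqrt (2 * pi) / \<epsilon> * std_normal_density ((t - s) / \<epsilon>)))"
  proof (rule Bochner_Integration.integral_cong[OF refl])
    fix t :: real
    have "(CLBINT x. K x t) = (CLBINT x. \<phi> t * (std_normal_density (\<epsilon> * x) * iexp ((s - t) * x)))"
      unfolding K_def by (intro Bochner_Integration.integral_cong) (auto simp: algebra_simps exp_add exp_diff exp_minus divide_simps)
    also have "\<dots> = \<phi> t * (CLBINT x. std_normal_density (\<epsilon> * x) * iexp ((s - t) * x))"
      by simp
    also have "(CLBINT x. std_normal_density (\<epsilon> * x) * iexp ((s - t) * x))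
      = (1 / \<epsilon>) * (CLBINT x. std_normal_density x * iexp (((s - t) / \<epsilon>) * x))"
      using lborel_integral_real_affine[of \<epsilon> "\<lambda>x. std_normal_density x * iexp (((s - t) / \<epsilon>) * x)" 0] \<epsilon>
      by (simp add: scaleR_conv_of_real)
    also have "\<dots> = (1 / \<epsilon>) * complex_of_real (exp (- (((s - t) / \<epsilon>)^2) / 2))"
      by (subst integral_std_normal_density_iexp) simp
    also have "\<dots> = sqrt (2 * pi) / \<epsilon> * std_normal_density ((t - s) / \<epsilon>)"
      by (simp add: std_normal_density_def power_divide power2_commute)
    finally show "(CLBINT x. K x t) = \<phi> t * (sqrt (2 * pi) / \<epsilon> * std_normal_density ((t - s) / \<epsilon>))" .
  qed
  also have "\<dots> = sqrt (2 * pi) * (CLBINT z. \<phi> (s + \<epsilon> * z) * std_normal_density z)"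
  proof -
    have "(CLBINT t. \<phi> t * (sqrt (2 * pi) / \<epsilon> * std_normal_density ((t - s) / \<epsilon>)))
      = \<epsilon> *\<^sub>R (CLBINT z. (sqrt (2 * pi) / \<epsilon>) * (\<phi> (s + \<epsilon> * z) * std_normal_density z))"
      using \<epsilon> by (subst lborel_integral_real_affine[of \<epsilon> _ s])
        (auto intro!: Bochner_Integration.integral_cong simp: mult_ac)
    also have "\<dots> = \<epsilon> *\<^sub>R ((sqrt (2 * pi) / \<epsilon>) * (CLBINT z. \<phi> (s + \<epsilon> * z) * std_normal_density z))"
      by (subst integral_mult_right_zero) (rule refl)
    finally show ?thesis using \<epsilon> by (simp add: scaleR_conv_of_real)
  qed
  finally show ?thesis .
qed

text \<open>Let the width in \<open>fourier_gaussian_mean\<close> tend to \<open>0\<close>, with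
  majorants \<open>cmod (P x)\<close> on one side and \<open>B * std_normal_density z\<close> on the
  other. One factor \<open>sqrt (2 * pi)\<close> is already present there, the other comes from
  \<open>std_normal_density 0 = 1 / sqrt (2 * pi)\<close>.\<close>

theorem fourier_inversion:
  fixes \<phi> :: "real \<Rightarrow> complex"
  defines "P \<equiv> \<lambda>x. CLBINT t. iexp (- (t * x)) * \<phi> t"
  assumes int: "integrable lborel \<phi>" and intP: "integrable lborel P"
    and cont: "isCont \<phi> s" and bdd: "\<And>t. cmod (\<phi> t) \<le> B"
  shows "(CLBINT x. iexp (s * x) * P x) = 2 * pi * \<phi> s"
proof -
  have [measurable]: "\<phi> \<in> borel_measurable borel" "P \<in> borel_measurable borel"
    using borel_measurable_integrable[OF int] borel_measurable_integrable[OF intP] by simp_all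
  let ?e = "\<lambda>n. 1 / real (Suc n)"
  let ?A = "\<lambda>n. CLBINT x. iexp (s * x) * P x * std_normal_density (?e n * x)"
  have e0: "?e \<longlonglongrightarrow> 0"
    using LIMSEQ_inverse_real_of_nat by (simp add: divide_inverse)
  have N0: "isCont std_normal_density x" for x
    unfolding std_normal_density_def by (intro continuous_intros) auto
  have Nle: "std_normal_density x \<le> 1" for x
  proof -
    have "1 \<le> sqrt (2 * pi)" using pi_ge_two by simp
    then have "1 * exp (- x\<^sup>2 / 2) / sqrt (2 * pi) \<le> 1"
      by (subst divide_le_eq) (auto intro: order_trans[of _ 1])
    then show ?thesis by (simp add: std_normal_density_def)
  qed
  have "?A \<longlonglongrightarrow> (CLBINT x. iexp (s * x) * P x * std_normal_density 0)"
  proof (rule integral_dominated_convergence[where w = "\<lambda>x. cmod (P x)"])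
    show "AE x in lborel. (\<lambda>n. iexp (s * x) * P x * std_normal_density (?e n * x))
        \<longlonglongrightarrow> iexp (s * x) * P x * std_normal_density 0"
    proof (intro AE_I2 tendsto_intros)
      fix x :: real
      have "(\<lambda>n. ?e n * x) \<longlonglongrightarrow> 0 * x"
        by (intro tendsto_intros e0)
      then show "(\<lambda>n. std_normal_density (?e n * x)) \<longlonglongrightarrow> std_normal_density 0"
        by (intro isCont_tendsto_compose[OF N0]) simp
    qed
    show "AE x in lborel. cmod (iexp (s * x) * P x * std_normal_density (?e n * x)) \<le> cmod (P x)" for n
      using mult_left_mono[OF Nle, of "cmod (P x)" "?e n * x" for x]
      by (auto simp: norm_mult)
  qed (use intP in auto)
  moreover have "?A = (\<lambda>n. sqrt (2 * pi) * (CLBINT z. \<phi> (s + ?e n * z) * std_normal_density z))"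
    unfolding P_def by (intro ext fourier_gaussian_mean[OF int]) simp
  moreover have "(\<lambda>n. sqrt (2 * pi) * (CLBINT z. \<phi> (s + ?e n * z) * std_normal_density z))
     \<longlonglongrightarrow> sqrt (2 * pi) * (CLBINT z. \<phi> s * std_normal_density z)"
  proof (intro tendsto_intros integral_dominated_convergence[where w = "\<lambda>z. B * std_normal_density z"])
    show "AE z in lborel. (\<lambda>n. \<phi> (s + ?e n * z) * std_normal_density z) \<longlonglongrightarrow> \<phi> s * std_normal_density z"
    proof (intro AE_I2 tendsto_intros)
      fix z :: real
      have "(\<lambda>n. s + ?e n * z) \<longlonglongrightarrow> s + 0 * z"
        by (intro tendsto_intros e0)
      then show "(\<lambda>n. \<phi> (s + ?e n * z)) \<longlonglongrightarrow> \<phi> s"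
        by (intro isCont_tendsto_compose[OF cont]) simp
    qed
    show "AE z in lborel. cmod (\<phi> (s + ?e n * z) * std_normal_density z) \<le> B * std_normal_density z" for n
      by (auto simp: norm_mult intro!: mult_right_mono bdd)
  qed auto
  ultimately have "(CLBINT x. iexp (s * x) * P x * std_normal_density 0)
      = sqrt (2 * pi) * (CLBINT z. \<phi> s * std_normal_density z)"
    by (simp only: LIMSEQ_unique)
  moreover have "(CLBINT z. complex_of_real (std_normal_density z)) = 1"
    using integral_std_normal_density_iexp[of 0] by simp
  ultimately have "(CLBINT x. iexp (s * x) * P x) / sqrt (2 * pi) = sqrt (2 * pi) * \<phi> s"
    by (simp add: std_normal_density_def)
  moreover have "complex_of_real (sqrt (2 * pi)) * complex_of_real (sqrt (2 * pi)) = 2 * pi"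
    by (simp only: of_real_mult[symmetric]) simp
  moreover have "complex_of_real (sqrt (2 * pi)) \<noteq> 0"
    by simp
  ultimately show ?thesis
    by (metis (no_types, lifting) mult.assoc mult.commute nonzero_divide_eq_eq)
qed

section \<open>Convex integrable functions as characteristic functions\<close>

text \<open>The law has density \<open>q / (2 * pi)\<close>, with \<open>q\<close> the cosine
  transform of \<open>f \<bar>t\<bar>\<close>. Convexity makes \<open>q\<close> nonnegative, and
  \<open>q\<close> is integrable because it is bounded and O(1/x^2); Fourier inversion then returns
  \<open>f\<close>.\<close>

theorem polya_criterion:
  fixes f f' f'' :: "real \<Rightarrow> real"
  assumes f0: "f 0 = 1"
    and D1: "\<And>t. 0 \<le> t \<Longrightarrow> (f has_real_derivative f' t) (at t)"
    and D2: "\<And>t. 0 \<le> t \<Longrightarrow> (f' has_real_derivative f'' t) (at t)"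
    and convex: "\<And>t. 0 \<le> t \<Longrightarrow> 0 \<le> f'' t"
    and int: "integrable lborel (\<lambda>t. f \<bar>t\<bar>)"
    and lim: "(f \<longlongrightarrow> 0) at_top" and lim': "(f' \<longlongrightarrow> 0) at_top"
  shows "\<exists>M. real_distribution M \<and> (\<forall>t. char M t = f \<bar>t\<bar>)"
proof -
  \<comment> \<open>Nondecreasing with limit \<open>0\<close>, \<open>f'\<close> is nonpositive; so
    \<open>f\<close> is nonincreasing with limit \<open>0\<close> and stays in [0, 1].\<close>
  have f'_mono: "f' s \<le> f' t" if "0 \<le> s" "s \<le> t" for s t
    by (rule DERIV_nonneg_imp_nondecreasing[OF that(2)]) (meson D2 convex order_trans that(1))
  have f'_le0: "f' t \<le> 0" if "0 \<le> t" for t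
    by (rule tendsto_lowerbound[OF lim'])
      (use that f'_mono in \<open>auto intro!: eventually_at_top_linorderI[of t]\<close>)
  have f_mono: "f t \<le> f s" if "0 \<le> s" "s \<le> t" for s t
    by (rule DERIV_nonpos_imp_nonincreasing[OF that(2)]) (meson D1 f'_le0 order_trans that(1))
  have f_ge0: "0 \<le> f t" if "0 \<le> t" for t
    by (rule tendsto_upperbound[OF lim])
      (use that f_mono in \<open>auto intro!: eventually_at_top_linorderI[of t]\<close>)
  have f_le1: "f t \<le> 1" if "0 \<le> t" for t
    using f_mono[of 0 t] that f0 by simp
  have [measurable]: "(\<lambda>t. f \<bar>t\<bar>) \<in> borel_measurable borel"
    using borel_measurable_integrable[OF int] by simp
  have f_cont: "continuous_on {0..} f"
    by (intro continuous_at_imp_continuous_on ballI DERIV_isCont[OF D1]) auto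
  have cont: "isCont (\<lambda>t. f \<bar>t\<bar>) s" for s
  proof -
    have "continuous_on UNIV (\<lambda>t. f \<bar>t\<bar>)"
      by (rule continuous_on_compose2[OF f_cont]) (auto intro!: continuous_intros)
    then show ?thesis by (simp add: continuous_on_eq_continuous_at)
  qed

  define q where "q x = (LBINT t. cos (t * x) * f \<bar>t\<bar>)" for x
  have int_trig: "integrable lborel (\<lambda>t. cos (t * x) * f \<bar>t\<bar>)"
    "integrable lborel (\<lambda>t. sin (t * x) * f \<bar>t\<bar>)" for x
    by (rule Bochner_Integration.integrable_bound[OF int];
        auto simp: abs_mult intro!: mult_left_le_one_le)+
  have [measurable]: "q \<in> borel_measurable borel"
    unfolding q_def by measurable
  have int_half: "integrable lborel (\<lambda>t. indicator {0..} t *\<^sub>R (cos (t * x) * f \<bar>t\<bar>))" for x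
    using integrable_mult_indicator[OF _ int_trig(1), of "{0..}"] by simp

  \<comment> \<open>The sine part of the transform vanishes by symmetry, which leaves the real
    function \<open>q\<close>.\<close>
  have P: "(CLBINT t. iexp (- (t * x)) * f \<bar>t\<bar>) = q x" for x
  proof (rule complex_eqI)
    have i: "integrable lborel (\<lambda>t. iexp (- (t * x)) * complex_of_real (f \<bar>t\<bar>))"
      by (rule Bochner_Integration.integrable_bound[OF int])
        (auto simp: norm_mult simp del: of_real_mult of_real_minus)
    show "Re (CLBINT t. iexp (- (t * x)) * f \<bar>t\<bar>) = Re (complex_of_real (q x))"
      unfolding q_def by (subst integral_Re[OF i, symmetric]) (auto simp: Re_exp)
    have "(LBINT t. sin (t * x) * f \<bar>t\<bar>) = - (LBINT t. sin (t * x) * f \<bar>t\<bar>)"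
      by (subst lborel_integral_real_affine[of "-1" _ 0]) auto
    then have "(LBINT t. sin (t * x) * f \<bar>t\<bar>) = 0" by simp
    then show "Im (CLBINT t. iexp (- (t * x)) * f \<bar>t\<bar>) = Im (complex_of_real (q x))"
      by (subst integral_Im[OF i, symmetric]) (auto simp: Im_exp)
  qed

  have q_half: "q x = 2 * (LBINT t. indicator {0..} t *\<^sub>R (cos (t * x) * f \<bar>t\<bar>))" for x
    using has_bochner_integral_even_function[OF has_bochner_integral_integrable[OF int_half[of x]]]
    unfolding q_def by (auto dest: has_bochner_integral_integral_eq)
  \<comment> \<open>Two integrations by parts: \<open>cos (t x) f t\<close> and \<open>f'' t (1 - cos (t x)) / x\<^sup>2 \<ge> 0\<close> differ by the
    derivative of \<open>G x\<close>, which gives both the sign and the quadratic decay of \<open>q\<close>.\<close>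
  define G where "G x t = f t * sin (t * x) / x - f' t * (1 - cos (t * x)) / x\<^sup>2" for x t
  have G_lim: "(G x \<longlongrightarrow> 0) at_top" for x
  proof -
    have "((\<lambda>t. (f t * sin (t * x)) * (1 / x) - (f' t * (1 - cos (t * x))) * (1 / x\<^sup>2))
        \<longlongrightarrow> 0 * (1 / x) - 0 * (1 / x\<^sup>2)) at_top"
    proof (intro tendsto_intros)
      show "((\<lambda>t. f t * sin (t * x)) \<longlongrightarrow> 0) at_top"
        by (rule Lim_null_comparison[OF _ tendsto_rabs_zero[OF lim]])
          (auto simp: abs_mult intro!: always_eventually mult_right_le_one_le)
      show "((\<lambda>t. f' t * (1 - cos (t * x))) \<longlongrightarrow> 0) at_top"
      proof (rule Lim_null_comparison[where g = "\<lambda>t. \<bar>f' t\<bar> * 2"])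
        show "((\<lambda>t. \<bar>f' t\<bar> * 2) \<longlongrightarrow> 0) at_top"
          using tendsto_mult_left_zero[OF tendsto_rabs_zero[OF lim'], of 2] .
        have "\<bar>1 - cos (t * x)\<bar> \<le> 2" for t
          using cos_ge_minus_one[of "t * x"] cos_le_one[of "t * x"] by linarith
        then show "\<forall>\<^sub>F t in at_top. norm (f' t * (1 - cos (t * x))) \<le> \<bar>f' t\<bar> * 2"
          by (auto simp: abs_mult intro!: always_eventually mult_left_mono)
      qed
    qed
    then show ?thesis by (simp add: G_def[abs_def])
  qed
  have q_T: "0 \<le> (LBINT t:{0..T}. cos (t * x) * f \<bar>t\<bar>) - G x T \<and>
     (LBINT t:{0..T}. cos (t * x) * f \<bar>t\<bar>) - G x T \<le> 2 * - f' 0 / x\<^sup>2"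
    if T: "T \<ge> 0" and x: "x \<noteq> 0" for x T
  proof -
    have c: "continuous_on {0..T} (\<lambda>t. cos (t * x) * f \<bar>t\<bar>)"
      by (intro continuous_intros continuous_at_imp_continuous_on ballI cont)
    have eq: "(LBINT t:{0..T}. cos (t * x) * f \<bar>t\<bar>) = integral {0..T} (\<lambda>t. cos (t * x) * f \<bar>t\<bar>)"
      by (intro set_borel_integral_eq_integral borel_integrable_atLeastAtMost' c)
    have 1: "((\<lambda>t. cos (t * x) * f \<bar>t\<bar>) has_integral integral {0..T} (\<lambda>t. cos (t * x) * f \<bar>t\<bar>)) {0..T}"
      by (intro integrable_integral integrable_continuous_real c)
    have 2: "((\<lambda>t. cos (t * x) * f \<bar>t\<bar> - f'' t * (1 - cos (t * x)) / x\<^sup>2) has_integral (G x T - G x 0)) {0..T}"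
    proof (rule fundamental_theorem_of_calculus[OF T])
      fix t assume t: "t \<in> {0..T}"
      have "(G x has_real_derivative cos (t * x) * f \<bar>t\<bar> - f'' t * (1 - cos (t * x)) / x\<^sup>2) (at t)"
        unfolding G_def using t x
        by (auto intro!: derivative_eq_intros D1 D2 simp: field_simps power2_eq_square)
      then show "(G x has_vector_derivative cos (t * x) * f \<bar>t\<bar> - f'' t * (1 - cos (t * x)) / x\<^sup>2)
          (at t within {0..T})"
        by (metis has_real_derivative_iff_has_vector_derivative has_vector_derivative_at_within)
    qed
    have 3: "((\<lambda>t. f'' t * (1 - cos (t * x)) / x\<^sup>2) has_integral
        (integral {0..T} (\<lambda>t. cos (t * x) * f \<bar>t\<bar>) - G x T)) {0..T}"
      using has_integral_diff[OF 1 2] by (simp add: G_def)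
    \<comment> \<open>For the upper bound, \<open>1 - cos (t * x)\<close> is at most
      \<open>2\<close>, and the integral of \<open>f''\<close> is at most \<open>- f' 0\<close>
      because \<open>f' T \<le> 0\<close>.\<close>
    have "(f'' has_integral (f' T - f' 0)) {0..T}"
      by (rule fundamental_theorem_of_calculus[OF T])
        (auto intro!: D2[THEN has_field_derivative_at_within] simp: has_real_derivative_iff_has_vector_derivative[symmetric])
    then have 4: "((\<lambda>t. f'' t * (2 / x\<^sup>2)) has_integral ((f' T - f' 0) * (2 / x\<^sup>2))) {0..T}"
      by (rule has_integral_mult_left)
    have "0 \<le> integral {0..T} (\<lambda>t. cos (t * x) * f \<bar>t\<bar>) - G x T"
      by (rule has_integral_nonneg[OF 3]) (auto intro!: divide_nonneg_nonneg mult_nonneg_nonneg convex)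
    moreover have "integral {0..T} (\<lambda>t. cos (t * x) * f \<bar>t\<bar>) - G x T \<le> (f' T - f' 0) * (2 / x\<^sup>2)"
    proof (rule has_integral_le[OF 3 4])
      fix t assume t: "t \<in> {0..T}"
      have "f'' t * (1 - cos (t * x)) \<le> f'' t * 2"
        using cos_ge_minus_one[of "t * x"] t by (intro mult_left_mono convex) auto
      then show "f'' t * (1 - cos (t * x)) / x\<^sup>2 \<le> f'' t * (2 / x\<^sup>2)"
        by (simp add: divide_right_mono)
    qed
    moreover have "(f' T - f' 0) * (2 / x\<^sup>2) \<le> - f' 0 * (2 / x\<^sup>2)"
      by (intro mult_right_mono) (use f'_le0[OF T] in auto)
    moreover have "- f' 0 * (2 / x\<^sup>2) = 2 * - f' 0 / x\<^sup>2"
      by simp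
    ultimately show ?thesis unfolding eq by linarith
  qed
  have q_lim: "((\<lambda>T. 2 * ((LBINT t:{0..T}. cos (t * x) * f \<bar>t\<bar>) - G x T)) \<longlongrightarrow> q x) at_top" for x
  proof -
    have "((\<lambda>T. LBINT t. indicator {..T} t *\<^sub>R (indicator {0..} t *\<^sub>R (cos (t * x) * f \<bar>t\<bar>)))
        \<longlongrightarrow> (LBINT t. indicator {0..} t *\<^sub>R (cos (t * x) * f \<bar>t\<bar>))) at_top"
      by (rule tendsto_integral_at_top[OF _ int_half]) simp
    moreover have "(\<lambda>T. LBINT t. indicator {..T} t *\<^sub>R (indicator {0..} t *\<^sub>R (cos (t * x) * f \<bar>t\<bar>)))
        = (\<lambda>T. LBINT t:{0..T}. cos (t * x) * f \<bar>t\<bar>)"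
      unfolding set_lebesgue_integral_def
      by (intro ext Bochner_Integration.integral_cong) (auto simp: indicator_def)
    ultimately have "((\<lambda>T. 2 * ((LBINT t:{0..T}. cos (t * x) * f \<bar>t\<bar>) - G x T))
        \<longlongrightarrow> 2 * ((LBINT t. indicator {0..} t *\<^sub>R (cos (t * x) * f \<bar>t\<bar>)) - 0)) at_top"
      by (intro tendsto_intros G_lim) auto
    then show ?thesis by (simp only: q_half diff_0_right)
  qed
  have q_ge0': "0 \<le> q x" if "x \<noteq> 0" for x
    by (rule tendsto_lowerbound[OF q_lim])
      (use that q_T in \<open>auto intro!: eventually_at_top_linorderI[of 0]\<close>)
  have q_ge0: "0 \<le> q x" for x
  proof (cases "x = 0")
    case True
    then show ?thesis
      by (auto simp: q_def intro!: integral_nonneg_AE f_ge0)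
  qed (rule q_ge0')
  \<comment> \<open>Twice the numerator of the bound in \<open>q_T\<close>, since \<open>q\<close>
    is twice the half-line integral.\<close>
  define D where "D = 4 * - f' 0"
  have D: "D \<ge> 0" using f'_le0[of 0] by (simp add: D_def)
  have q_tail: "q x * x\<^sup>2 \<le> D" for x
  proof (cases "x = 0")
    case False
    have "q x \<le> 2 * (2 * - f' 0 / x\<^sup>2)"
      by (rule tendsto_upperbound[OF q_lim])
        (use False q_T in \<open>force intro!: eventually_at_top_linorderI[of 0]\<close>)+
    then show ?thesis using False by (simp add: D_def field_simps)
  qed (use D in auto)
  define C where "C = (LBINT t. f \<bar>t\<bar>)"
  have q_C: "q x \<le> C" for x
    unfolding q_def C_def
    by (intro integral_mono int int_trig) (use mult_right_mono[OF cos_le_one f_ge0] in simp)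
  \<comment> \<open>Adding the bounds \<open>q x \<le> C\<close> and
    \<open>q x * x\<^sup>2 \<le> D\<close> puts \<open>q\<close> below a multiple of the Cauchy
    density.\<close>
  have int_q: "integrable lborel q"
  proof (rule Bochner_Integration.integrable_bound)
    show "integrable lborel (\<lambda>x. (C + D) * inverse (1 + x\<^sup>2))"
      using integrable_inverse_1_plus_square by (simp add: set_integrable_def)
    show "AE x in lborel. norm (q x) \<le> norm ((C + D) * inverse (1 + x\<^sup>2))"
    proof (rule AE_I2)
      fix x :: real
      have "q x * (1 + x\<^sup>2) \<le> C + D"
        using q_tail[of x] q_C[of x] by (simp add: algebra_simps)
      moreover have "1 + x\<^sup>2 > 0"
        by (simp add: add_pos_nonneg)
      ultimately have "q x \<le> (C + D) * inverse (1 + x\<^sup>2)"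
        by (simp add: field_simps)
      then show "norm (q x) \<le> norm ((C + D) * inverse (1 + x\<^sup>2))"
        using q_ge0[of x] by (simp only: real_norm_def)
    qed
  qed simp

  have inv: "(CLBINT x. iexp (s * x) * q x) = complex_of_real (2 * pi) * f \<bar>s\<bar>" for s
  proof -
    have "(CLBINT x. iexp (s * x) * (CLBINT t. iexp (- (t * x)) * f \<bar>t\<bar>)) = complex_of_real (2 * pi) * f \<bar>s\<bar>"
    proof (rule fourier_inversion)
      show "integrable lborel (\<lambda>t. complex_of_real (f \<bar>t\<bar>))"
        using int by simp
      show "integrable lborel (\<lambda>x. CLBINT t. iexp (- (t * x)) * f \<bar>t\<bar>)"
        unfolding P using int_q by simp
      show "isCont (\<lambda>t. complex_of_real (f \<bar>t\<bar>)) s"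
        by (intro isCont_of_real cont)
      show "cmod (complex_of_real (f \<bar>t\<bar>)) \<le> 1" for t
        using f_ge0[of "\<bar>t\<bar>"] f_le1[of "\<bar>t\<bar>"] by simp
    qed
    then show ?thesis unfolding P .
  qed
  \<comment> \<open>Inversion at \<open>0\<close>, where \<open>f\<close> is \<open>1\<close>, gives
    this measure total mass one; inversion at \<open>s\<close> gives its characteristic
    function.\<close>
  define M where "M = density lborel (\<lambda>x. ennreal (q x / (2 * pi)))"
  have "complex_of_real (LBINT x. q x) = complex_of_real (2 * pi)"
    using inv[of 0] f0 by simp
  then have total: "(LBINT x. q x) = 2 * pi"
    by (simp only: of_real_eq_iff)
  have "emeasure M (space M) = (\<integral>\<^sup>+ x. ennreal (q x / (2 * pi)) \<partial>lborel)"
    unfolding M_def by (simp add: emeasure_density)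
  also have "\<dots> = ennreal (LBINT x. q x / (2 * pi))"
    by (rule nn_integral_eq_integral) (use int_q q_ge0 in auto)
  also have "\<dots> = 1" by (simp add: total)
  finally have "prob_space M" by (rule prob_spaceI)
  then have "real_distribution M"
    unfolding real_distribution_def real_distribution_axioms_def by (simp add: M_def)
  moreover have "char M s = f \<bar>s\<bar>" for s
  proof -
    have "char M s = (CLBINT x. (q x / (2 * pi)) *\<^sub>R iexp (s * x))"
      unfolding char_def M_def by (subst integral_density) (use q_ge0 in auto)
    also have "\<dots> = (CLBINT x. (iexp (s * x) * q x) / (2 * pi))"
      by (intro Bochner_Integration.integral_cong) (auto simp: scaleR_conv_of_real)
    also have "\<dots> = f \<bar>s\<bar>"
      by (subst integral_divide_zero, subst inv) simp
    finally show ?thesis .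
  qed
  ultimately show ?thesis by blast
qed

section \<open>Characteristic functions with a prescribed exponent\<close>

text \<open>The quadratic Taylor bound puts 1 + a^2 t^2 / 2 below the growing exponential, and
  multiplication by \<open>1 + 2 / a\<^sup>2\<close> lifts it above \<open>1 + t\<^sup>2\<close>.
  This supplies an integrable majorant.\<close>

lemma exp_neg_abs_le:
  fixes a t :: real
  assumes "a > 0"
  shows "exp (- (a * \<bar>t\<bar>)) \<le> (1 + 2 / a\<^sup>2) * inverse (1 + t\<^sup>2)"
proof -
  have "1 + (a * \<bar>t\<bar>) + (a * \<bar>t\<bar>)\<^sup>2 / 2 \<le> exp (a * \<bar>t\<bar>)"
    using assms by (intro exp_lower_Taylor_quadratic) simp
  then have "1 + a\<^sup>2 * t\<^sup>2 / 2 \<le> exp (a * \<bar>t\<bar>)"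
    using assms by (simp add: power_mult_distrib) (smt (verit) mult_nonneg_nonneg)
  then have "(1 + 2 / a\<^sup>2) * (1 + a\<^sup>2 * t\<^sup>2 / 2) \<le> (1 + 2 / a\<^sup>2) * exp (a * \<bar>t\<bar>)"
    using assms by (intro mult_left_mono) auto
  moreover have "1 + t\<^sup>2 \<le> (1 + 2 / a\<^sup>2) * (1 + a\<^sup>2 * t\<^sup>2 / 2)"
    using assms by (simp add: field_simps)
  ultimately have "1 + t\<^sup>2 \<le> (1 + 2 / a\<^sup>2) * exp (a * \<bar>t\<bar>)" by linarith
  moreover have "1 + t\<^sup>2 > 0" by (simp add: add_pos_nonneg)
  ultimately show ?thesis by (simp add: exp_minus divide_simps mult_ac)
qed

text \<open>The second derivative of \<open>exp (- h t)\<close> is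
  \<open>((h' t)\<^sup>2 - h'' t) * exp (- h t)\<close>, so convexity follows from
  \<open>h' t \<ge> a\<close> and \<open>h'' t \<le> a\<^sup>2\<close>. The consequence
  \<open>a * t \<le> h t\<close> gives integrability, and the linear bound on \<open>h'\<close>
  makes the first derivative vanish at infinity.\<close>

theorem polya_criterion_exp:
  fixes h h' h'' :: "real \<Rightarrow> real"
  assumes a: "a > 0" and h0: "h 0 = 0"
    and D1: "\<And>t. 0 \<le> t \<Longrightarrow> (h has_real_derivative h' t) (at t)"
    and D2: "\<And>t. 0 \<le> t \<Longrightarrow> (h' has_real_derivative h'' t) (at t)"
    and h'_ge: "\<And>t. 0 \<le> t \<Longrightarrow> a \<le> h' t" and h'_le: "\<And>t. 0 \<le> t \<Longrightarrow> h' t \<le> b + c * t"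
    and h''_le: "\<And>t. 0 \<le> t \<Longrightarrow> h'' t \<le> a\<^sup>2"
  shows "\<exists>M. real_distribution M \<and> (\<forall>t. char M t = exp (- h \<bar>t\<bar>))"
proof -
  have h_ge: "a * t \<le> h t" if "t \<ge> 0" for t
  proof -
    have "h 0 - a * 0 \<le> h t - a * t"
    proof (rule DERIV_nonneg_imp_nondecreasing[OF that])
      fix x assume "0 \<le> x" "x \<le> t"
      then show "\<exists>y. ((\<lambda>x. h x - a * x) has_real_derivative y) (at x) \<and> 0 \<le> y"
        using h'_ge by (intro exI[of _ "h' x - a"]) (auto intro!: derivative_eq_intros D1)
    qed
    then show ?thesis by (simp add: h0)
  qed
  have cont: "continuous_on {0..} h"
    by (intro continuous_at_imp_continuous_on ballI DERIV_isCont[OF D1]) auto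
  have "continuous_on UNIV (\<lambda>t. exp (- h \<bar>t\<bar>))"
    by (intro continuous_intros continuous_on_compose2[OF cont]) auto
  then have [measurable]: "(\<lambda>t. exp (- h \<bar>t\<bar>)) \<in> borel_measurable borel"
    by (rule borel_measurable_continuous_onI)
  show ?thesis
  proof (rule polya_criterion)
    show "exp (- h 0) = 1" by (simp add: h0)
    show "((\<lambda>t. exp (- h t)) has_real_derivative - h' t * exp (- h t)) (at t)" if "0 \<le> t" for t
      by (auto intro!: derivative_eq_intros D1 that)
    show "((\<lambda>t. - h' t * exp (- h t)) has_real_derivative ((h' t)\<^sup>2 - h'' t) * exp (- h t)) (at t)"
      if "0 \<le> t" for t
      by (auto intro!: derivative_eq_intros D1 D2 that simp: algebra_simps power2_eq_square)
    show "0 \<le> ((h' t)\<^sup>2 - h'' t) * exp (- h t)" if "0 \<le> t" for t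
      using power_mono[OF h'_ge[OF that], of 2] h''_le[OF that] a by simp
    show "integrable lborel (\<lambda>t. exp (- h \<bar>t\<bar>))"
    proof (rule Bochner_Integration.integrable_bound)
      show "integrable lborel (\<lambda>x. (1 + 2 / a\<^sup>2) * inverse (1 + x\<^sup>2))"
        using integrable_inverse_1_plus_square by (simp add: set_integrable_def)
      show "AE t in lborel. norm (exp (- h \<bar>t\<bar>)) \<le> norm ((1 + 2 / a\<^sup>2) * inverse (1 + t\<^sup>2))"
      proof (rule AE_I2)
        fix t :: real
        have "exp (- h \<bar>t\<bar>) \<le> exp (- (a * \<bar>t\<bar>))"
          using h_ge[of "\<bar>t\<bar>"] by simp
        also have "\<dots> \<le> (1 + 2 / a\<^sup>2) * inverse (1 + t\<^sup>2)"
          by (rule exp_neg_abs_le[OF a])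
        finally show "norm (exp (- h \<bar>t\<bar>)) \<le> norm ((1 + 2 / a\<^sup>2) * inverse (1 + t\<^sup>2))"
          by simp
      qed
    qed simp
    show "((\<lambda>t. exp (- h t)) \<longlongrightarrow> 0) at_top"
    proof (rule Lim_null_comparison)
      show "((\<lambda>t. exp (- (a * t))) \<longlongrightarrow> 0) at_top" using a by real_asymp
      show "\<forall>\<^sub>F t in at_top. norm (exp (- h t)) \<le> exp (- (a * t))"
        using h_ge by (auto intro!: eventually_at_top_linorderI[of 0])
    qed
    show "((\<lambda>t. - h' t * exp (- h t)) \<longlongrightarrow> 0) at_top"
    proof (rule Lim_null_comparison)
      show "((\<lambda>t. (b + c * t) * exp (- (a * t))) \<longlongrightarrow> 0) at_top" using a by real_asymp
      show "\<forall>\<^sub>F t in at_top. norm (- h' t * exp (- h t)) \<le> (b + c * t) * exp (- (a * t))"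
      proof (rule eventually_at_top_linorderI[of 0])
        fix t :: real assume t: "0 \<le> t"
        then show "norm (- h' t * exp (- h t)) \<le> (b + c * t) * exp (- (a * t))"
          using h'_ge[OF t] h'_le[OF t] h_ge[OF t] a by (auto simp: abs_mult intro!: mult_mono)
      qed
    qed
  qed
qed

text \<open>Every derivative of \<open>cos (ln (1 + t))\<close> gains a factor
  \<open>1 / (1 + t)\<close>, so the oscillating term has a bounded second derivative although it is
  of order t^2. The linear term keeps the first derivative of the exponent at least
  \<open>3\<close>, and the square of \<open>3\<close> exceeds the bound on the second
  derivative.\<close>

lemma ex_char_oscillating:
  fixes \<delta> :: real
  assumes \<delta>: "\<bar>\<delta>\<bar> \<le> 1 / 2"
  shows "\<exists>M. real_distribution M \<and>
    (\<forall>t. char M t = exp (- (3 * \<bar>t\<bar> + t\<^sup>2 * (1 + \<delta> * cos (ln (1 + \<bar>t\<bar>))))))"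
proof -
  \<comment> \<open>On the half-line \<open>r\<close> lies in [0, 1] and absorbs the factors t / (1
    + t) from the chain rule. As t r' = r (1 - r), the derivative of \<open>t * r t\<close> is
    \<open>2 * r t - (r t)\<^sup>2\<close>.\<close>
  define r where "r t = t / (1 + t)" for t :: real
  define h where "h t = 3 * t + t\<^sup>2 * (1 + \<delta> * cos (ln (1 + t)))" for t
  define h' where "h' t = 3 + 2 * t * (1 + \<delta> * cos (ln (1 + t))) - \<delta> * (t * r t * sin (ln (1 + t)))" for t
  define h'' where "h'' t = 2 * (1 + \<delta> * cos (ln (1 + t))) - 2 * (\<delta> * (r t * sin (ln (1 + t))))
    - \<delta> * ((2 * r t - (r t)\<^sup>2) * sin (ln (1 + t))) - \<delta> * ((r t)\<^sup>2 * cos (ln (1 + t)))" for t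
  have small: "\<bar>\<delta> * (x * y)\<bar> \<le> 1 / 2" if "\<bar>x\<bar> \<le> 1" "\<bar>y\<bar> \<le> 1" for x y :: real
  proof -
    have "\<bar>\<delta>\<bar> * (\<bar>x\<bar> * \<bar>y\<bar>) \<le> 1 / 2 * (1 * 1)"
      by (intro mult_mono \<delta> that) auto
    then show ?thesis by (simp add: abs_mult)
  qed
  have r: "0 \<le> r t" "r t \<le> 1" if "0 \<le> t" for t
    using that by (auto simp: r_def)
  have r2: "\<bar>(r t)\<^sup>2\<bar> \<le> 1" "\<bar>2 * r t - (r t)\<^sup>2\<bar> \<le> 1" if "0 \<le> t" for t
  proof -
    show "\<bar>(r t)\<^sup>2\<bar> \<le> 1" using r[OF that] by (simp add: power_le_one)
    have "2 * r t - (r t)\<^sup>2 = 1 - (1 - r t)\<^sup>2" by (simp add: power2_eq_square algebra_simps)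
    moreover have "(1 - r t)\<^sup>2 \<le> 1" using r[OF that] by (simp add: power_le_one)
    ultimately show "\<bar>2 * r t - (r t)\<^sup>2\<bar> \<le> 1" by simp
  qed
  have small_cos: "\<bar>\<delta> * cos x\<bar> \<le> 1 / 2" for x
    using small[of 1 "cos x"] by simp
  have lin: "t / 2 \<le> t * (1 + \<delta> * cos x)" "t * (1 + \<delta> * cos x) \<le> 3 / 2 * t" if "0 \<le> t" for t x
  proof -
    have "1 / 2 \<le> 1 + \<delta> * cos x" "1 + \<delta> * cos x \<le> 3 / 2"
      using small_cos[of x] unfolding abs_le_iff by linarith+
    from this[THEN mult_left_mono, OF that]
    show "t / 2 \<le> t * (1 + \<delta> * cos x)" "t * (1 + \<delta> * cos x) \<le> 3 / 2 * t"
      by simp_all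
  qed
  have sin_term: "\<bar>\<delta> * (t * r t * sin x)\<bar> \<le> t / 2" if "0 \<le> t" for t x
    using mult_left_mono[OF small[of "r t" "sin x"] that] r[OF that] that
    by (simp add: abs_mult mult_ac)
  have "\<exists>M. real_distribution M \<and> (\<forall>t. char M t = exp (- h \<bar>t\<bar>))"
  proof (rule polya_criterion_exp)
    show "(3 :: real) > 0" "h 0 = 0" by (simp_all add: h_def)
    fix t :: real assume t: "0 \<le> t"
    show "(h has_real_derivative h' t) (at t)"
      unfolding h_def h'_def using t
      by (auto intro!: derivative_eq_intros simp: r_def power2_eq_square)
    have r': "(r has_real_derivative (1 - r t) / (1 + t)) (at t)"
      unfolding r_def using t
      by (auto intro!: derivative_eq_intros simp: divide_simps)
    have tr: "t * (1 / (1 + t)) = r t" "t * ((1 - r t) / (1 + t)) = r t * (1 - r t)"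
      by (simp_all add: r_def)
    have "(h' has_real_derivative
        2 * (1 + \<delta> * cos (ln (1 + t))) - 2 * (\<delta> * (t * (1 / (1 + t)) * sin (ln (1 + t))))
        - \<delta> * ((r t + t * ((1 - r t) / (1 + t))) * sin (ln (1 + t)))
        - \<delta> * (t * (1 / (1 + t)) * r t * cos (ln (1 + t)))) (at t)"
      unfolding h'_def using t
      by (auto intro!: derivative_eq_intros r' simp: algebra_simps)
    then show "(h' has_real_derivative h'' t) (at t)"
      unfolding tr h''_def by (simp add: power2_eq_square algebra_simps)
    show "3 \<le> h' t" "h' t \<le> 3 + 4 * t"
      using lin[OF t, of "ln (1 + t)"] sin_term[OF t, of "ln (1 + t)"] t
      unfolding h'_def by linarith+
    \<comment> \<open>The four summands are at most 3, 1, 1/2 and 1/2, with sum 5 < 9.\<close>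
    show "h'' t \<le> 3\<^sup>2"
      using small_cos[of "ln (1 + t)"] small[of "r t" "sin (ln (1 + t))"]
        small[of "(r t)\<^sup>2" "cos (ln (1 + t))"] small[of "2 * r t - (r t)\<^sup>2" "sin (ln (1 + t))"]
        r[OF t] r2[OF t]
      unfolding h''_def by simp
  qed
  then show ?thesis by (simp add: h_def)
qed

lemma ex_char_cauchy:
  assumes "a > 0"
  shows "\<exists>M. real_distribution M \<and> (\<forall>t. char M t = exp (- (a * \<bar>t\<bar>)))"
  by (rule polya_criterion_exp[where h' = "\<lambda>_. a" and h'' = "\<lambda>_. 0" and b = a and c = 0 and a = a])
    (use assms in \<open>auto intro!: derivative_eq_intros\<close>)

text \<open>Along the integer parts of exp (x + 2 pi k) the sequence tends to \<open>cos x\<close>,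
  because rounding is negligible after taking the logarithm. A limit would thus equal both
  \<open>cos 0\<close> and \<open>cos pi\<close>.\<close>

lemma not_convergent_cos_ln: "\<not> convergent (\<lambda>n. cos (ln (1 + real n)))"
proof
  assume "convergent (\<lambda>n. cos (ln (1 + real n)))"
  then obtain L where L: "(\<lambda>n. cos (ln (1 + real n))) \<longlonglongrightarrow> L"
    by (auto simp: convergent_def)
  have "L = cos x" for x
  proof -
    define y where "y k = x + real k * (2 * pi)" for k
    define N where "N k = nat \<lfloor>exp (y k)\<rfloor>" for k
    have y: "filterlim y at_top sequentially"
      unfolding y_def by real_asymp
    have N: "real (N k) = \<lfloor>exp (y k)\<rfloor>" for k
      unfolding N_def by simp
    have "filterlim (\<lambda>k. real (N k)) at_top sequentially"
      unfolding N by (rule filterlim_compose[OF _ y]) real_asymp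
    then have "filterlim N at_top sequentially"
      by (simp add: filterlim_sequentially_iff_filterlim_real)
    then have 1: "(\<lambda>k. cos (ln (1 + real (N k)))) \<longlonglongrightarrow> L"
      by (rule filterlim_compose[OF L])
    have "(\<lambda>k. ln (1 + real (N k)) - y k) \<longlonglongrightarrow> 0"
      unfolding N by (rule filterlim_compose[OF _ y]) real_asymp
    then have "(\<lambda>k. cos (x + (ln (1 + real (N k)) - y k))) \<longlonglongrightarrow> cos (x + 0)"
      by (intro tendsto_intros)
    moreover have "cos (x + (ln (1 + real (N k)) - y k)) = cos (ln (1 + real (N k)))" for k
    proof -
      have "ln (1 + real (N k)) = x + (ln (1 + real (N k)) - y k) + 2 * real k * pi"
        by (simp add: y_def)
      then have "cos (ln (1 + real (N k))) = cos (x + (ln (1 + real (N k)) - y k) + 2 * real k * pi)"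
        by (rule arg_cong)
      then show ?thesis
        unfolding cos_add[of _ "2 * real k * pi"] by (simp only: cos_2npi sin_2npi mult_1_right mult_zero_right diff_0_right)
    qed
    ultimately show "L = cos x"
      using 1 by (simp add: LIMSEQ_unique)
  qed
  from this[of 0] this[of pi] show False by simp
qed

section \<open>Characteristic functions of infinitely divisible laws\<close>

lemma real_distribution_convolution:
  assumes "real_distribution M" "real_distribution N"
  shows "real_distribution (M \<star> N)"
proof -
  interpret M: real_distribution M by fact
  interpret N: real_distribution N by fact
  interpret pair_prob_space M N ..
  have "prob_space (M \<star> N)"
    unfolding convolution_def by (rule prob_space_distr) simp
  then show ?thesis
    by (simp add: real_distribution_def real_distribution_axioms_def)
qed

lemma char_convolution:
  assumes "real_distribution M" "real_distribution N"
  shows "char (M \<star> N) t = char M t * char N t"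
proof -
  interpret M: real_distribution M by fact
  interpret N: real_distribution N by fact
  interpret pair_prob_space M N ..
  have int: "integrable (M \<Otimes>\<^sub>M N) (\<lambda>(x, y). iexp (t * x) * iexp (t * y))"
    by (rule integrable_const_bound[where B = 1]) (auto simp: norm_mult norm_exp_i_times simp del: of_real_mult)
  have "char (M \<star> N) t = (CLINT p|M \<Otimes>\<^sub>M N. (\<lambda>(x, y). iexp (t * x) * iexp (t * y)) p)"
    unfolding char_def convolution_def
    by (subst integral_distr) (auto intro!: Bochner_Integration.integral_cong simp: distrib_left exp_add)
  also have "\<dots> = (CLINT x|M. CLINT y|N. iexp (t * x) * iexp (t * y))"
    using integral_fst'[OF int] by simp
  also have "\<dots> = char M t * char N t"
    by (simp add: char_def)
  finally show ?thesis .
qed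

lemma char_distr_mult:
  assumes "real_distribution M"
  shows "char (distr M borel (\<lambda>x. c * x)) t = char M (c * t)"
proof -
  interpret real_distribution M by fact
  show ?thesis
    unfolding char_def by (subst integral_distr) (auto simp: mult_ac)
qed

lemma real_distribution_distr_mult:
  assumes "real_distribution M"
  shows "real_distribution (distr M borel (\<lambda>x. c * x))"
proof -
  interpret real_distribution M by fact
  show ?thesis by (rule real_distribution_distr) simp
qed

lemma char_uminus:
  assumes "real_distribution M"
  shows "char M (- t) = cnj (char M t)"
  unfolding char_def Bochner_Integration.integral_cnj[symmetric] by (simp add: exp_cnj)

lemma char_return_0: "char (return borel 0) t = 1"
  unfolding char_def by (subst integral_return) auto

lemma df_conv_power_cdf:
  assumes "real_distribution M"
  shows "\<exists>K. real_distribution K \<and> df_conv_power (cdf M) n = cdf K \<and> (\<forall>t. char K t = char M t ^ n)"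
proof (induction n)
  case 0
  interpret prob_space "return borel (0 :: real)" by (rule prob_space_return) simp
  have "real_distribution (return borel (0 :: real))" by unfold_locales simp
  then show ?case by (auto simp: char_return_0)
next
  case (Suc n)
  then obtain K where K: "real_distribution K" "df_conv_power (cdf M) n = cdf K" "\<And>t. char K t = char M t ^ n"
    by blast
  show ?case
    using K assms
    by (intro exI[of _ "M \<star> K"]) (auto simp: df_conv_cdf real_distribution_convolution char_convolution)
qed

lemma cdf_eq_iff_char:
  assumes "real_distribution M" "real_distribution N"
  shows "cdf M = cdf N \<longleftrightarrow> (\<forall>t. char M t = char N t)"
  using assms cdf_unique[of M N] Levy_uniqueness[of M N] by (metis ext)

text \<open>Levy uniqueness turns the convolution equations into equations between characteristic
  functions; \<open>cdf_infinitely_divisible_iff\<close> is the bridge.\<close>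

definition infdiv_law :: "real measure \<Rightarrow> bool" where
  "infdiv_law M \<longleftrightarrow> real_distribution M \<and>
    (\<forall>n>0. \<exists>N. real_distribution N \<and> (\<forall>t. char M t = char N t ^ n))"

lemma cdf_infinitely_divisible_iff:
  assumes M: "real_distribution M"
  shows "cdf M \<in> infinitely_divisible \<longleftrightarrow> infdiv_law M"
proof -
  have "(\<exists>G. distribution_function G \<and> cdf M = df_conv_power G n) \<longleftrightarrow>
      (\<exists>N. real_distribution N \<and> (\<forall>t. char M t = char N t ^ n))" for n
  proof -
    have "cdf M = df_conv_power (cdf N) n \<longleftrightarrow> (\<forall>t. char M t = char N t ^ n)" if "real_distribution N" for N
      using df_conv_power_cdf[OF that, of n] cdf_eq_iff_char[OF M] by metis
    then show ?thesis unfolding distribution_function_def by metis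
  qed
  then show ?thesis
    using M by (auto simp: infinitely_divisible_def infdiv_law_def distribution_function_def)
qed

section \<open>Subadditivity for infinitely divisible laws\<close>

text \<open>Since 1 - cos x = 2 sin^2 (x/2), this is the squared subadditivity of |sin|. The weights
  \<open>1 + l\<close> and \<open>1 + 1 / l\<close> replace the cross term, so that the inequality
  is linear in 1 - cos and can be integrated.\<close>

lemma one_minus_cos_add_le:
  fixes a b l :: real
  assumes "l > 0"
  shows "1 - cos (a + b) \<le> (1 + l) * (1 - cos a) + (1 + 1 / l) * (1 - cos b)"
proof -
  define p q where "p = sin (a / 2)" and "q = sin (b / 2)"
  have c: "1 - cos x = 2 * (sin (x / 2))\<^sup>2" for x :: real
    using cos_double_sin[of "x / 2"] by simp
  have "\<bar>sin ((a + b) / 2)\<bar> \<le> \<bar>p\<bar> + \<bar>q\<bar>"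
  proof -
    have "sin ((a + b) / 2) = p * cos (b / 2) + cos (a / 2) * q"
      by (simp add: add_divide_distrib sin_add p_def q_def)
    moreover have "\<bar>p * cos (b / 2)\<bar> \<le> \<bar>p\<bar>" "\<bar>cos (a / 2) * q\<bar> \<le> \<bar>q\<bar>"
      by (auto simp: abs_mult intro!: mult_right_le_one_le mult_left_le_one_le)
    ultimately show ?thesis by linarith
  qed
  then have "(sin ((a + b) / 2))\<^sup>2 \<le> (\<bar>p\<bar> + \<bar>q\<bar>)\<^sup>2"
    using power_mono[of "\<bar>sin ((a + b) / 2)\<bar>" "\<bar>p\<bar> + \<bar>q\<bar>" 2] by simp
  also have "\<dots> \<le> (1 + l) * p\<^sup>2 + (1 + 1 / l) * q\<^sup>2"
  proof -
    have "0 \<le> (l * \<bar>p\<bar> - \<bar>q\<bar>)\<^sup>2 / l" using assms by simp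
    also have "\<dots> = (1 + l) * p\<^sup>2 + (1 + 1 / l) * q\<^sup>2 - (\<bar>p\<bar> + \<bar>q\<bar>)\<^sup>2"
      using assms by (simp add: power2_eq_square field_simps)
    finally show ?thesis by simp
  qed
  finally show ?thesis unfolding c p_def q_def by (simp add: algebra_simps)
qed

lemma one_minus_cmod_char_add_le:
  assumes M: "real_distribution M" and l: "l > 0"
  shows "1 - (cmod (char M (s + t)))\<^sup>2
    \<le> (1 + l) * (1 - (cmod (char M s))\<^sup>2) + (1 + 1 / l) * (1 - (cmod (char M t))\<^sup>2)"
proof -
  \<comment> \<open>\<open>S\<close> is the symmetrisation of \<open>M\<close>, so that \<open>|char M|\<^sup>2\<close> is again a characteristic function.\<close>
  define S where "S = (M \<star> distr M borel (\<lambda>x. - 1 * x))"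
  have S: "real_distribution S"
    unfolding S_def by (intro real_distribution_convolution real_distribution_distr_mult M)
  interpret real_distribution S by fact
  have charS: "char S u = (cmod (char M u))\<^sup>2" for u
    unfolding S_def char_convolution[OF M real_distribution_distr_mult[OF M]] char_distr_mult[OF M]
    using char_uminus[OF M, of u] complex_norm_square[of "char M u"] by simp
  have int: "integrable S (\<lambda>x. cos (u * x))" for u
    by (rule integrable_const_bound[where B = 1]) auto
  have i: "integrable S (\<lambda>x. iexp (u * x))" for u
    by (rule integrable_const_bound[where B = 1]) (auto simp: norm_exp_i_times simp del: of_real_mult)
  \<comment> \<open>As \<open>char S\<close> is real, 1 - |char M|^2 is the mean of
    \<open>1 - cos (u * x)\<close> under \<open>S\<close>, and the pointwise inequality for cosines
    carries over.\<close>
  have *: "1 - (cmod (char M u))\<^sup>2 = (LINT x|S. 1 - cos (u * x))" for u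
  proof -
    have "(cmod (char M u))\<^sup>2 = Re (char S u)" by (simp add: charS)
    also have "\<dots> = (LINT x|S. cos (u * x))"
      unfolding char_def by (subst integral_Re[OF i, symmetric]) (simp add: Re_exp)
    finally show ?thesis using int[of u] prob_space by (simp del: space_eq_univ)
  qed
  have "(LINT x|S. 1 - cos ((s + t) * x))
      \<le> (LINT x|S. (1 + l) * (1 - cos (s * x)) + (1 + 1 / l) * (1 - cos (t * x)))"
  proof (rule integral_mono)
    show "1 - cos ((s + t) * x) \<le> (1 + l) * (1 - cos (s * x)) + (1 + 1 / l) * (1 - cos (t * x))" for x
      unfolding distrib_right[of s] by (rule one_minus_cos_add_le[OF l])
  qed (use int in simp_all)
  also have "\<dots> = (1 + l) * (LINT x|S. 1 - cos (s * x)) + (1 + 1 / l) * (LINT x|S. 1 - cos (t * x))"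
    by (subst Bochner_Integration.integral_add) (use int in auto)
  finally show ?thesis unfolding * .
qed

text \<open>This limit turns estimates for convolution roots into estimates for logarithms.\<close>

lemma tendsto_mult_one_minus_root:
  fixes x :: real
  assumes "x > 0"
  shows "(\<lambda>n. real n * (1 - root n x)) \<longlonglongrightarrow> - ln x"
proof -
  have "(\<lambda>n. real n * (1 - x powr (1 / real n))) \<longlonglongrightarrow> - ln x"
    using assms by real_asymp
  moreover have "\<forall>\<^sub>F n in sequentially. real n * (1 - x powr (1 / real n)) = real n * (1 - root n x)"
    using eventually_gt_at_top[of 0] by eventually_elim (use assms in \<open>simp add: root_powr_inverse\<close>)
  ultimately show ?thesis by (rule Lim_transform_eventually)
qed

text \<open>The estimate \<open>one_minus_cmod_char_add_le\<close> is applied to an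
  \<open>n\<close>-th convolution root. The squared modulus of its characteristic function is a real
  \<open>n\<close>-th root, so no branch of a complex root has to be chosen.\<close>

lemma infdiv_law_root_le:
  assumes M: "infdiv_law M" and n: "n > 0" and l: "l > 0"
  shows "1 - root n ((cmod (char M (s + t)))\<^sup>2)
    \<le> (1 + l) * (1 - root n ((cmod (char M s))\<^sup>2)) + (1 + 1 / l) * (1 - root n ((cmod (char M t))\<^sup>2))"
proof -
  obtain N where N: "real_distribution N" "\<And>t. char M t = char N t ^ n"
    using M n by (auto simp: infdiv_law_def)
  have "root n ((cmod (char M u))\<^sup>2) = (cmod (char N u))\<^sup>2" for u
  proof -
    have "(cmod (char M u))\<^sup>2 = ((cmod (char N u))\<^sup>2) ^ n"
      by (simp add: N norm_power power_mult[symmetric] mult.commute)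
    then show ?thesis using n by (simp add: real_root_power_cancel)
  qed
  then show ?thesis using one_minus_cmod_char_add_le[OF N(1) l] by simp
qed

text \<open>Zeros propagate by halving: if \<open>2 * u\<close> is a zero and \<open>u\<close> is
  not, the root estimate with \<open>l = 1\<close> bounds \<open>1\<close> by a sequence tending to
  \<open>0\<close>. The zeros \<open>t / 2 ^ k\<close> then contradict continuity at
  \<open>0\<close>, where the value is \<open>1\<close>.\<close>

lemma infdiv_law_char_nonzero:
  assumes M: "infdiv_law M"
  shows "char M t \<noteq> 0"
proof
  assume zero: "char M t = 0"
  interpret real_distribution M using M by (simp add: infdiv_law_def)
  have half: "char M (t / 2 ^ k) = 0" for k
  proof (induction k)
    case (Suc k)
    show ?case
    proof (rule ccontr)
      define u where "u = t / 2 ^ Suc k"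
      assume "char M (t / 2 ^ Suc k) \<noteq> 0"
      then have nz: "(cmod (char M u))\<^sup>2 > 0" by (simp add: u_def)
      have "u + u = t / 2 ^ k" by (simp add: u_def)
      then have "1 \<le> 4 * (1 - root n ((cmod (char M u))\<^sup>2))" if "n > 0" for n
        using infdiv_law_root_le[OF M that, of 1 u u] Suc that by simp
      moreover have "(\<lambda>n. 4 * (1 - root n ((cmod (char M u))\<^sup>2))) \<longlonglongrightarrow> 4 * (1 - 1)"
        by (intro tendsto_intros LIMSEQ_root_const nz)
      ultimately have "1 \<le> 4 * (1 - 1 :: real)"
        by (intro tendsto_lowerbound[where F = sequentially]) (auto intro!: eventually_sequentiallyI[of 1])
      then show False by simp
    qed
  qed (use zero in simp)
  have "(\<lambda>k. char M (t / 2 ^ k)) \<longlonglongrightarrow> char M 0"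
    by (intro isCont_tendsto_compose[OF isCont_char]) real_asymp
  then have "char M 0 = 0" by (simp add: half LIMSEQ_const_iff)
  then show False by (simp add: char_zero)
qed

text \<open>The infimum of the right-hand side over \<open>l > 0\<close> is
  \<open>(a + b)\<^sup>2\<close>; optimising the weight restores the cross term.\<close>

lemma le_square_sum_if_le_weighted:
  fixes a b c :: real
  assumes "a \<ge> 0" "b \<ge> 0" and le: "\<And>l. l > 0 \<Longrightarrow> c \<le> (1 + l) * a\<^sup>2 + (1 + 1 / l) * b\<^sup>2"
  shows "c \<le> (a + b)\<^sup>2"
proof -
  have bound: "c \<le> (a + b + 2 * e) * (a + b)" if e: "e > 0" for e
  proof -
    \<comment> \<open>The optimal weight is \<open>b / a\<close>; the shift by \<open>e\<close> covers \<open>a = 0\<close> and \<open>b = 0\<close>.\<close>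
    have "c \<le> (1 + (b + e) / (a + e)) * a\<^sup>2 + (1 + 1 / ((b + e) / (a + e))) * b\<^sup>2"
      using assms e by (intro le) auto
    also have "\<dots> = (a + b + 2 * e) * (a / (a + e)) * a + (a + b + 2 * e) * (b / (b + e)) * b"
      using assms e by (simp add: power2_eq_square divide_simps) (simp add: algebra_simps)
    also have "\<dots> \<le> (a + b + 2 * e) * 1 * a + (a + b + 2 * e) * 1 * b"
      using assms e by (intro add_mono mult_right_mono mult_left_mono) auto
    finally show ?thesis by (simp add: algebra_simps)
  qed
  have "((\<lambda>e. (a + b + 2 * e) * (a + b)) \<longlongrightarrow> (a + b + 2 * 0) * (a + b)) (at_right 0)"
    by (intro tendsto_intros)
  then have "c \<le> (a + b + 2 * 0) * (a + b)"
    by (rule tendsto_lowerbound) (use bound in \<open>auto simp: eventually_at_right_less intro: eventually_at_rightI[of 0 1]\<close>)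
  then show ?thesis by (simp add: power2_eq_square)
qed

text \<open>For fixed \<open>l\<close>, multiply the root estimate by \<open>n\<close> and let
  \<open>n\<close> tend to infinity; only then optimise over \<open>l\<close> and take square
  roots.\<close>

lemma infdiv_law_sqrt_ln_subadditive:
  assumes M: "infdiv_law M"
  defines "\<psi> \<equiv> \<lambda>t. sqrt (- ln ((cmod (char M t))\<^sup>2))"
  shows "\<psi> (s + t) \<le> \<psi> s + \<psi> t"
proof -
  interpret real_distribution M using M by (simp add: infdiv_law_def)
  have pos: "(cmod (char M u))\<^sup>2 > 0" for u
    using infdiv_law_char_nonzero[OF M] by simp
  have nonneg: "0 \<le> - ln ((cmod (char M u))\<^sup>2)" for u
    using pos[of u] cmod_char_le_1[of u] by (simp add: power_le_one)
  have "- ln ((cmod (char M (s + t)))\<^sup>2) \<le> (1 + l) * (- ln ((cmod (char M s))\<^sup>2)) + (1 + 1 / l) * (- ln ((cmod (char M t))\<^sup>2))"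
    if l: "l > 0" for l
  proof (rule tendsto_le[OF sequentially_bot])
    show "(\<lambda>n. real n * (1 - root n ((cmod (char M (s + t)))\<^sup>2))) \<longlonglongrightarrow> - ln ((cmod (char M (s + t)))\<^sup>2)"
      by (intro tendsto_mult_one_minus_root pos)
    show "(\<lambda>n. (1 + l) * (real n * (1 - root n ((cmod (char M s))\<^sup>2))) + (1 + 1 / l) * (real n * (1 - root n ((cmod (char M t))\<^sup>2))))
       \<longlonglongrightarrow> (1 + l) * (- ln ((cmod (char M s))\<^sup>2)) + (1 + 1 / l) * (- ln ((cmod (char M t))\<^sup>2))"
      by (intro tendsto_intros tendsto_mult_one_minus_root pos)
    show "\<forall>\<^sub>F n in sequentially. real n * (1 - root n ((cmod (char M (s + t)))\<^sup>2))
       \<le> (1 + l) * (real n * (1 - root n ((cmod (char M s))\<^sup>2))) + (1 + 1 / l) * (real n * (1 - root n ((cmod (char M t))\<^sup>2)))"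
      using eventually_gt_at_top[of 0]
    proof eventually_elim
      case (elim n)
      show ?case
        using mult_left_mono[OF infdiv_law_root_le[OF M elim l, of s t], of "real n"]
        by (simp only: distrib_left mult.left_commute of_nat_0_le_iff)
    qed
  qed
  then have "- ln ((cmod (char M (s + t)))\<^sup>2) \<le> (\<psi> s + \<psi> t)\<^sup>2"
    by (intro le_square_sum_if_le_weighted) (use nonneg in \<open>auto simp: \<psi>_def\<close>)
  then have "\<psi> (s + t) \<le> sqrt ((\<psi> s + \<psi> t)\<^sup>2)"
    unfolding \<psi>_def by (rule real_sqrt_le_mono)
  also have "\<dots> = \<psi> s + \<psi> t"
    using nonneg by (simp add: \<psi>_def)
  finally show ?thesis .
qed

section \<open>Fekete's lemma and the quadratic growth rate\<close>

lemma fekete: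
  fixes u :: "nat \<Rightarrow> real"
  assumes nonneg: "\<And>n. u n \<ge> 0" and sub: "\<And>m n. u (m + n) \<le> u m + u n"
  shows "convergent (\<lambda>n. u n / n)"
proof -
  \<comment> \<open>The index starts at 1, since the default value \<open>u 0 / 0 = 0\<close> would
    force the infimum to be \<open>0\<close>.\<close>
  define L where "L = (INF n\<in>{1..}. u n / real n)"
  have bdd: "bdd_below ((\<lambda>n. u n / real n) ` {1..})"
    by (intro bdd_belowI[of _ 0]) (auto simp: nonneg)
  have lower: "L \<le> u n / n" if "n \<ge> 1" for n
    unfolding L_def by (rule cINF_lower[OF bdd]) (use that in simp)
  \<comment> \<open>The case \<open>q = 0\<close> would claim \<open>u 0 \<le> 0\<close>, which
    subadditivity does not give.\<close>
  have mult: "u (q * m) \<le> q * u m" if "q \<ge> 1" for q m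
    using that
  proof (induction q rule: dec_induct)
    case (step q)
    then show ?case using sub[of m "q * m"] by (simp add: algebra_simps)
  qed simp
  have mult1: "u (q * m + r) \<le> q * u m + u r" for q m r
    using mult[of q m] sub[of "q * m" r] by (cases "q = 0") auto
  have "(\<lambda>n. u n / n) \<longlonglongrightarrow> L"
  proof (rule order_tendstoI)
    fix a assume "a < L"
    then show "\<forall>\<^sub>F n in sequentially. a < u n / n"
      by (intro eventually_sequentiallyI[of 1]) (use lower in fastforce)
  next
    fix a assume a: "L < a"
    then obtain m where m: "m \<ge> 1" "u m / m < a"
      using cINF_less_iff[OF _ bdd, of a] by (auto simp: L_def)
    \<comment> \<open>For n = q m + r with r < m, the remainder term \<open>u r\<close> is at most
      \<open>B\<close>, which disappears after division by \<open>n\<close>.\<close>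
    define B where "B = Max (u ` {..<m})"
    have B: "u r \<le> B" if "r < m" for r
      unfolding B_def using that by (intro Max_ge) auto
    have B0: "B \<ge> 0" using B[of 0] nonneg[of 0] m by simp
    have upper: "u n / n \<le> u m / m + B / n" if n: "n \<ge> 1" for n
    proof -
      have "u n \<le> (n div m) * u m + u (n mod m)"
        using mult1[of "n div m" m "n mod m"] by simp
      also have "\<dots> \<le> (n / m) * u m + B"
        using m by (intro add_mono mult_right_mono nonneg B of_nat_div_le_of_nat) auto
      finally show ?thesis using n m by (simp add: field_simps)
    qed
    have "(\<lambda>n. u m / m + B / real n) \<longlonglongrightarrow> u m / m"
      by real_asymp
    then have "\<forall>\<^sub>F n in sequentially. u m / m + B / real n < a"
      by (rule order_tendstoD) (rule m)
    then show "\<forall>\<^sub>F n in sequentially. u n / n < a"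
      using eventually_ge_at_top[of 1] by eventually_elim (use upper in fastforce)
  qed
  then show ?thesis by (rule convergentI)
qed

lemma infdiv_law_ln_char_convergent:
  assumes M: "infdiv_law M"
  shows "convergent (\<lambda>n. ln (cmod (char M (real n))) / (real n)\<^sup>2)"
proof -
  interpret real_distribution M using M by (simp add: infdiv_law_def)
  define u where "u n = sqrt (- ln ((cmod (char M (real n)))\<^sup>2))" for n
  have nonneg: "0 \<le> - ln ((cmod (char M x))\<^sup>2)" for x
    using infdiv_law_char_nonzero[OF M, of x] cmod_char_le_1[of x] by (simp add: power_le_one)
  have "convergent (\<lambda>n. u n / n)"
    by (rule fekete) (use nonneg infdiv_law_sqrt_ln_subadditive[OF M] in \<open>auto simp: u_def\<close>)
  then obtain L where "(\<lambda>n. u n / n) \<longlonglongrightarrow> L" by (auto simp: convergent_def)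
  then have "(\<lambda>n. - (1/2) * (u n / n)\<^sup>2) \<longlonglongrightarrow> - (1/2) * L\<^sup>2"
    by (intro tendsto_intros)
  \<comment> \<open>The factor is due to \<open>u n\<close> having square -2 ln |char M n|. At
    \<open>n = 0\<close> both sides are \<open>0\<close> by the convention for division.\<close>
  moreover have "- (1/2) * (u n / n)\<^sup>2 = ln (cmod (char M (real n))) / (real n)\<^sup>2" for n
    using nonneg[of n] infdiv_law_char_nonzero[OF M, of n]
    by (simp add: u_def power_divide ln_realpow)
  ultimately show ?thesis by (auto simp: convergent_def)
qed

text \<open>The characteristic functions of the two infinitely divisible laws vanish nowhere, so ln
  |char M| is a difference of two logarithms whose quadratic growth rates exist.\<close>

lemma rational_infinitely_divisible_ln_char_convergent:
  assumes M: "real_distribution M" and Q: "cdf M \<in> rational_infinitely_divisible"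
  shows "convergent (\<lambda>n. ln (cmod (char M (real n))) / (real n)\<^sup>2)"
proof -
  obtain H1 H2 where H: "H1 \<in> infinitely_divisible" "H2 \<in> infinitely_divisible" "H1 = df_conv (cdf M) H2"
    using Q by (auto simp: rational_infinitely_divisible_def)
  obtain M1 M2 where M12: "real_distribution M1" "H1 = cdf M1" "real_distribution M2" "H2 = cdf M2"
    using H by (auto simp: infinitely_divisible_def distribution_function_def)
  have inf: "infdiv_law M1" "infdiv_law M2"
    using H(1,2) M12 by (metis cdf_infinitely_divisible_iff)+
  have "cdf M1 = cdf (M \<star> M2)"
    using H M12 by (simp add: df_conv_cdf[OF M])
  then have eq: "char M1 t = char M t * char M2 t" for t
    using M12 M by (simp add: cdf_eq_iff_char real_distribution_convolution char_convolution)
  have nz: "char M1 t \<noteq> 0" "char M2 t \<noteq> 0" for t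
    using inf infdiv_law_char_nonzero by auto
  have "ln (cmod (char M t)) = ln (cmod (char M1 t)) - ln (cmod (char M2 t))" for t
    using nz[of t] by (simp add: eq norm_mult ln_mult)
  then show ?thesis
    using convergent_diff[OF infdiv_law_ln_char_convergent[OF inf(1)] infdiv_law_ln_char_convergent[OF inf(2)]]
    by (simp add: diff_divide_distrib)
qed

section \<open>The factorisation\<close>

lemma ex_char_cauchy_normal:
  assumes "a > 0" "b \<ge> 0"
  shows "\<exists>M. real_distribution M \<and> (\<forall>t. char M t = exp (- (a * \<bar>t\<bar> + b * t\<^sup>2)))"
proof -
  obtain C where C: "real_distribution C" "\<And>t. char C t = exp (- (a * \<bar>t\<bar>))"
    using ex_char_cauchy[OF assms(1)] by auto
  \<comment> \<open>Variance \<open>2 * b\<close> yields the factor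
    \<open>exp (- (b * t\<^sup>2))\<close>; for \<open>b = 0\<close> this is the point mass at
    \<open>0\<close>.\<close>
  define G where "G = distr std_normal_distribution borel (\<lambda>x. sqrt (2 * b) * x)"
  have G: "real_distribution G"
    unfolding G_def by (intro real_distribution_distr_mult real_dist_normal_dist)
  have "char G t = exp (- (b * t\<^sup>2))" for t
    unfolding G_def char_distr_mult[OF real_dist_normal_dist] char_std_normal_distribution
    using assms by (simp add: power_mult_distrib)
  then have "char (C \<star> G) t = exp (- (a * \<bar>t\<bar> + b * t\<^sup>2))" for t
    unfolding char_convolution[OF C(1) G] C(2) by (simp add: exp_add[symmetric] exp_of_real[symmetric])
  with real_distribution_convolution[OF C(1) G] show ?thesis by blast
qed

text \<open>The \<open>n\<close>-th convolution root belongs to the same family, with parameters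
  \<open>a / n\<close> and \<open>b / n\<close>.\<close>

lemma infdiv_law_cauchy_normal:
  assumes M: "real_distribution M" and char: "\<And>t. char M t = exp (- (a * \<bar>t\<bar> + b * t\<^sup>2))"
    and "a > 0" "b \<ge> 0"
  shows "infdiv_law M"
  unfolding infdiv_law_def
proof (intro conjI allI impI M)
  fix n :: nat assume n: "n > 0"
  obtain N where N: "real_distribution N" "\<And>t. char N t = exp (- (a / n * \<bar>t\<bar> + b / n * t\<^sup>2))"
    using ex_char_cauchy_normal[of "a / n" "b / n"] assms n by auto
  have "exp (- (a * \<bar>t\<bar> + b * t\<^sup>2)) = exp (- (a / n * \<bar>t\<bar> + b / n * t\<^sup>2)) ^ n" for t
    using n by (subst exp_of_nat_mult[symmetric]) (simp add: field_simps)
  then have "char M t = char N t ^ n" for t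
    unfolding char N(2) by (simp only: of_real_power)
  then show "\<exists>N. real_distribution N \<and> (\<forall>t. char M t = char N t ^ n)"
    using N(1) by blast
qed

text \<open>For positive n, ln |char M n| / n^2 is -3/n - 1 - \<open>\<delta>\<close> cos (ln (1 +
  n)). A limit would force the cosine to converge, against
  \<open>not_convergent_cos_ln\<close>.\<close>

lemma oscillating_not_rational_infinitely_divisible:
  assumes M: "real_distribution M"
    and char: "\<And>t. char M t = exp (- (3 * \<bar>t\<bar> + t\<^sup>2 * (1 + \<delta> * cos (ln (1 + \<bar>t\<bar>)))))"
    and "\<delta> \<noteq> 0"
  shows "cdf M \<notin> rational_infinitely_divisible"
proof
  assume "cdf M \<in> rational_infinitely_divisible"
  then obtain L where "(\<lambda>n. ln (cmod (char M (real n))) / (real n)\<^sup>2) \<longlonglongrightarrow> L"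
    using rational_infinitely_divisible_ln_char_convergent[OF M] by (auto simp: convergent_def)
  then have "(\<lambda>n. (- (ln (cmod (char M (real n))) / (real n)\<^sup>2) - 3 / real n - 1) / \<delta>) \<longlonglongrightarrow> (- L - 0 - 1) / \<delta>"
    using \<open>\<delta> \<noteq> 0\<close> by (intro tendsto_intros lim_const_over_n)
  moreover have "\<forall>\<^sub>F n in sequentially.
      (- (ln (cmod (char M (real n))) / (real n)\<^sup>2) - 3 / real n - 1) / \<delta> = cos (ln (1 + real n))"
    using eventually_gt_at_top[of 0]
  proof eventually_elim
    case (elim n)
    then show ?case
      using \<open>\<delta> \<noteq> 0\<close> unfolding char by (simp add: field_simps power2_eq_square)
  qed
  ultimately have "(\<lambda>n. cos (ln (1 + real n))) \<longlonglongrightarrow> (- L - 0 - 1) / \<delta>"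
    by (rule Lim_transform_eventually)
  then show False
    using not_convergent_cos_ln by (auto simp: convergent_def)
qed

theorem theorem2:
  shows "\<exists>F F1 F2 :: real \<Rightarrow> real.
    distribution_function F \<and> distribution_function F1 \<and> distribution_function F2 \<and>
    F = df_conv F1 F2 \<and>
    F \<in> infinitely_divisible \<and>
    F1 \<notin> rational_infinitely_divisible \<and>
    F2 \<notin> rational_infinitely_divisible"
proof -
  \<comment> \<open>With the opposite amplitudes 1/2 and -1/2 the oscillations cancel in the
    product, which leaves the exponent 6|t| + 2t^2.\<close>
  have "\<bar>1 / 2 :: real\<bar> \<le> 1 / 2" "\<bar>- 1 / 2 :: real\<bar> \<le> 1 / 2" by simp_all
  from ex_char_oscillating[OF this(1)] ex_char_oscillating[OF this(2)] obtain M1 M2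
    where M1: "real_distribution M1"
        "\<And>t. char M1 t = exp (- (3 * \<bar>t\<bar> + t\<^sup>2 * (1 + 1 / 2 * cos (ln (1 + \<bar>t\<bar>)))))"
      and M2: "real_distribution M2"
        "\<And>t. char M2 t = exp (- (3 * \<bar>t\<bar> + t\<^sup>2 * (1 + - 1 / 2 * cos (ln (1 + \<bar>t\<bar>)))))"
    by blast
  have M: "real_distribution (M1 \<star> M2)"
    by (intro real_distribution_convolution M1 M2)
  have "char (M1 \<star> M2) t = exp (- (6 * \<bar>t\<bar> + 2 * t\<^sup>2))" for t
    unfolding char_convolution[OF M1(1) M2(1)] M1(2) M2(2) of_real_mult[symmetric] exp_add[symmetric]
    by (simp add: algebra_simps)
  then have "infdiv_law (M1 \<star> M2)"
    by (rule infdiv_law_cauchy_normal[OF M]) simp_all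
  then have "cdf (M1 \<star> M2) \<in> infinitely_divisible"
    by (simp add: cdf_infinitely_divisible_iff[OF M])
  moreover have "cdf M1 \<notin> rational_infinitely_divisible"
    by (rule oscillating_not_rational_infinitely_divisible[OF M1]) simp
  moreover have "cdf M2 \<notin> rational_infinitely_divisible"
    by (rule oscillating_not_rational_infinitely_divisible[OF M2]) simp
  moreover have "cdf (M1 \<star> M2) = df_conv (cdf M1) (cdf M2)"
    by (simp add: df_conv_cdf M1(1) M2(1))
  ultimately show ?thesis
    using M M1(1) M2(1) unfolding distribution_function_def by blast
qed

end
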